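(* Let $(Q,\diamond,\star)$ be a rack-pairing. Define a binary operation $\triangleright:Q\times Q\rightarrow Q$ by $x\triangleright y := (L_x^{\diamond})^{-1}(x\star y)$ for $x,y\in Q$, where $L_x^{\diamond}=x\diamond -:Q\to Q$. Then $(Q,\diamond,\triangleright)$ is a di-rack. Moreover, if $\varphi:Q\rightarrow Q'$ is a morphism of rack-pairings from $(Q,\diamond,\star)$ to $(Q',\diamond',\star')$, then $\varphi$ is also a morphism of di-racks from $(Q,\diamond,\triangleright)$ to $(Q',\diamond',\triangleright')$, where $\triangleright'$ is defined from $(Q',\diamond',\star')$ by $x'\triangleright' y' := (L_{x'}^{\diamond'})^{-1}(x'\star' y')$.
   Context: A (left) rack $(Q,\diamond)$ is a nonempty set $Q$ with a binary operation $\diamond$ such that $x\diamond(y\diamond z) = (x\diamond y)\diamond(x\diamond z)$ for all $x,y,z$, and for any $x,y$ there is a unique $c$ with $x\diamond c = y$ (so each $L_x^\diamond$ is bijective). A rack-pairing is a triple $(Q,\diamond,\star)$ such that $(Q,\diamond)$ and $(Q,\star)$ are racks and $x\star(y\diamond z) = (x\star y)\diamond(x\star z)$ for all $x,y,z$. A di-rack $(Q,\diamond,\triangleright)$ is a rack $(Q,\diamond)$ with a binary operation $\triangleright$ such that: for each $x\in Q$ the map $x\triangleright -:Q\to Q$ is bijective and $x\triangleright(y\diamond z) = (x\triangleright y)\diamond(x\triangleright z)$ for all $x,y,z$; and $x\diamond(x\triangleright(y\triangleright z)) = (x\diamond(x\triangleright y))\triangleright(x\diamond(x\triangleright z))$ for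 all $x,y,z\in Q$. Morphisms of rack-pairings and of di-racks are maps preserving both binary operations. *)

theory Defs
  imports "HOL-Library.FuncSet"
begin

text \<open>
  Racks live on an explicit carrier \<open>Q\<close>; the values of the operations outside \<open>Q\<close> are
  unconstrained.  All racks are left racks.
\<close>

locale rack =
  fixes Q :: "'a set"
    and op_rack :: "'a \<Rightarrow> 'a \<Rightarrow> 'a"  (infixr "\<diamondop>" 70)
  assumes carrier_nonempty: "Q \<noteq> {}"
    and rack_closed: "(\<diamondop>) \<in> Q \<rightarrow> Q \<rightarrow> Q"
    and rack_self_distrib:
      "\<lbrakk>x \<in> Q; y \<in> Q; z \<in> Q\<rbrakk> \<Longrightarrow> x \<diamondop> (y \<diamondop> z) = (x \<diamondop> y) \<diamondop> (x \<diamondop> z)"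
    and rack_unique_solution: "\<lbrakk>x \<in> Q; y \<in> Q\<rbrakk> \<Longrightarrow> \<exists>!c. c \<in> Q \<and> x \<diamondop> c = y"

locale rack_pairing =
  rack Q op_rack + star: rack Q op_star
  for Q :: "'a set"
    and op_rack :: "'a \<Rightarrow> 'a \<Rightarrow> 'a"  (infixr "\<diamondop>" 70)
    and op_star :: "'a \<Rightarrow> 'a \<Rightarrow> 'a"  (infixr "\<star>" 70) +
  assumes star_distrib:
      "\<lbrakk>x \<in> Q; y \<in> Q; z \<in> Q\<rbrakk> \<Longrightarrow> x \<star> (y \<diamondop> z) = (x \<star> y) \<diamondop> (x \<star> z)"

locale di_rack =
  rack Q op_rack
  for Q :: "'a set"
    and op_rack :: "'a \<Rightarrow> 'a \<Rightarrow> 'a"  (infixr "\<diamondop>" 70) +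
  fixes op_tri :: "'a \<Rightarrow> 'a \<Rightarrow> 'a"  (infixr "\<triangleright>" 70)
  assumes tri_closed: "(\<triangleright>) \<in> Q \<rightarrow> Q \<rightarrow> Q"
    and tri_bij: "x \<in> Q \<Longrightarrow> bij_betw (\<lambda>y. x \<triangleright> y) Q Q"
    and tri_distrib:
      "\<lbrakk>x \<in> Q; y \<in> Q; z \<in> Q\<rbrakk> \<Longrightarrow> x \<triangleright> (y \<diamondop> z) = (x \<triangleright> y) \<diamondop> (x \<triangleright> z)"
    and rack_tri_distrib:
      "\<lbrakk>x \<in> Q; y \<in> Q; z \<in> Q\<rbrakk> \<Longrightarrow>
        x \<diamondop> (x \<triangleright> (y \<triangleright> z)) = (x \<diamondop> (x \<triangleright> y)) \<triangleright> (x \<diamondop> (x \<triangleright> z))"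

definition preserves_op ::
    "'a set \<Rightarrow> ('a \<Rightarrow> 'a \<Rightarrow> 'a) \<Rightarrow> ('b \<Rightarrow> 'b \<Rightarrow> 'b) \<Rightarrow> ('a \<Rightarrow> 'b) \<Rightarrow> bool" where
  "preserves_op Q f g \<phi> \<longleftrightarrow> (\<forall>x\<in>Q. \<forall>y\<in>Q. \<phi> (f x y) = g (\<phi> x) (\<phi> y))"

locale rack_pairing_morphism =
  source: rack_pairing Q op_rack op_star + target: rack_pairing Q' op_rack' op_star'
  for Q :: "'a set" and op_rack op_star
    and Q' :: "'b set" and op_rack' op_star' +
  fixes \<phi> :: "'a \<Rightarrow> 'b"
  assumes map_carrier: "\<phi> \<in> Q \<rightarrow> Q'"
    and map_rack: "preserves_op Q op_rack op_rack' \<phi>"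
    and map_star: "preserves_op Q op_star op_star' \<phi>"

locale di_rack_morphism =
  source: di_rack Q op_rack op_tri + target: di_rack Q' op_rack' op_tri'
  for Q :: "'a set" and op_rack op_tri
    and Q' :: "'b set" and op_rack' op_tri' +
  fixes \<phi> :: "'a \<Rightarrow> 'b"
  assumes map_carrier: "\<phi> \<in> Q \<rightarrow> Q'"
    and map_rack: "preserves_op Q op_rack op_rack' \<phi>"
    and map_tri: "preserves_op Q op_tri op_tri' \<phi>"

text \<open>
  Left translation by \<open>x\<close> is only bijective on \<open>Q\<close>, hence the inverse relative to \<open>Q\<close>.
\<close>

definition pairing_tri ::
    "'a set \<Rightarrow> ('a \<Rightarrow> 'a \<Rightarrow> 'a) \<Rightarrow> ('a \<Rightarrow> 'a \<Rightarrow> 'a) \<Rightarrow> 'a \<Rightarrow> 'a \<Rightarrow> 'a" where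
  "pairing_tri Q op_rack op_star x y = inv_into Q (\<lambda>z. op_rack x z) (op_star x y)"

end

theory Submission
  imports Defs
begin

text \<open>
  The operation \<open>\<triangleright>\<close> is characterised by \<open>x \<diamondop> (x \<triangleright> y) = x \<star> y\<close>.  Every identity about \<open>\<triangleright>\<close>
  follows by applying a left translation of \<open>\<diamondop>\<close>, which is injective, to both sides and rewriting
  with this equation; in particular the last di-rack axiom becomes
  \<open>x \<star> (y \<triangleright> z) = (x \<star> y) \<triangleright> (x \<star> z)\<close>.
\<close>

context rack
begin

lemma rack_mem: "x \<in> Q \<Longrightarrow> y \<in> Q \<Longrightarrow> x \<diamondop> y \<in> Q"
  using rack_closed by auto

lemma rack_left_cancel:
  "\<lbrakk>x \<in> Q; y \<in> Q; z \<in> Q; x \<diamondop> y = x \<diamondop> z\<rbrakk> \<Longrightarrow> y = z"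
  using rack_unique_solution[of x "x \<diamondop> y"] rack_mem[of x y] by auto

text \<open>Serves both racks of a pairing: for \<diamondop> it makes \<open>inv_into\<close> a
  genuine inverse on \<open>Q\<close>, for \<star> it yields the other bijective factor of
  \<open>x \<triangleright> -\<close>.\<close>

lemma left_translation_bij: "x \<in> Q \<Longrightarrow> bij_betw (\<lambda>y. x \<diamondop> y) Q Q"
  by (rule bij_betwI'[OF _ rack_mem]) (blast dest: rack_left_cancel, assumption, assumption,
      metis rack_unique_solution)

end

context rack_pairing
begin

abbreviation tri :: "'a \<Rightarrow> 'a \<Rightarrow> 'a"  (infixr "\<triangleright>" 70) where
  "(\<triangleright>) \<equiv> pairing_tri Q (\<diamondop>) (\<star>)"

lemma tri_mem: "x \<in> Q \<Longrightarrow> y \<in> Q \<Longrightarrow> x \<triangleright> y \<in> Q"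
  unfolding pairing_tri_def
  by (metis bij_betw_imp_surj_on inv_into_into left_translation_bij star.rack_mem)

lemma rack_tri: "x \<in> Q \<Longrightarrow> y \<in> Q \<Longrightarrow> x \<diamondop> (x \<triangleright> y) = x \<star> y"
  unfolding pairing_tri_def
  by (rule bij_betw_inv_into_right[OF left_translation_bij star.rack_mem])

lemma tri_eqI:
  "\<lbrakk>x \<in> Q; y \<in> Q; z \<in> Q; x \<diamondop> z = x \<star> y\<rbrakk> \<Longrightarrow> x \<triangleright> y = z"
  by (metis rack_left_cancel rack_tri tri_mem)

text \<open>The map \<open>x \<star> -\<close> is an endomorphism of both \<diamondop> and \<star>,
  hence of the operation \<triangleright> that they determine.\<close>

lemma star_tri_distrib:
  assumes "x \<in> Q" "y \<in> Q" "z \<in> Q"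
  shows "x \<star> (y \<triangleright> z) = (x \<star> y) \<triangleright> (x \<star> z)"
proof (rule sym, rule tri_eqI)
  \<comment> \<open>Both sides equal \<open>x \<star> (y \<star> z)\<close>: on the left, pull
    \<open>x \<star> -\<close> out of \<diamondop> and use \<open>rack_tri\<close>.\<close>
  show "(x \<star> y) \<diamondop> (x \<star> (y \<triangleright> z)) = (x \<star> y) \<star> (x \<star> z)"
    using assms by (metis rack_tri star.rack_self_distrib star_distrib tri_mem)
qed (use assms in \<open>simp_all add: star.rack_mem tri_mem\<close>)

lemma di_rack_pairing_tri: "di_rack Q (\<diamondop>) (\<triangleright>)"
proof unfold_locales
  show "(\<triangleright>) \<in> Q \<rightarrow> Q \<rightarrow> Q"
    by (simp add: tri_mem)
next
  fix x assume x: "x \<in> Q"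
  have "bij_betw (inv_into Q (\<lambda>z. x \<diamondop> z) \<circ> (\<lambda>y. x \<star> y)) Q Q"
    by (rule bij_betw_trans[OF star.left_translation_bij[OF x]
          bij_betw_inv_into[OF left_translation_bij[OF x]]])
  then show "bij_betw (\<lambda>y. x \<triangleright> y) Q Q"
    by (simp add: pairing_tri_def comp_def)
next
  fix x y z assume Q: "x \<in> Q" "y \<in> Q" "z \<in> Q"
  show "x \<triangleright> (y \<diamondop> z) = (x \<triangleright> y) \<diamondop> (x \<triangleright> z)"
  proof (rule tri_eqI)
    \<comment> \<open>Both sides expand to
      \<open>(x \<star> y) \<diamondop> (x \<star> z)\<close>.\<close>
    show "x \<diamondop> ((x \<triangleright> y) \<diamondop> (x \<triangleright> z)) = x \<star> (y \<diamondop> z)"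
      using Q by (simp add: rack_self_distrib tri_mem rack_tri star_distrib)
  qed (use Q in \<open>simp_all add: rack_mem tri_mem\<close>)
  show "x \<diamondop> (x \<triangleright> (y \<triangleright> z)) = (x \<diamondop> (x \<triangleright> y)) \<triangleright> (x \<diamondop> (x \<triangleright> z))"
    using Q by (simp add: rack_tri tri_mem star_tri_distrib)
qed

end

text \<open>The argument of \<open>star_tri_distrib\<close>, with \<phi> in place of
  \<open>x \<star> -\<close>.\<close>

lemma (in rack_pairing_morphism) di_rack_morphism_pairing_tri:
  "di_rack_morphism Q op_rack (pairing_tri Q op_rack op_star)
     Q' op_rack' (pairing_tri Q' op_rack' op_star') \<phi>"
proof -
  have "preserves_op Q (pairing_tri Q op_rack op_star) (pairing_tri Q' op_rack' op_star') \<phi>"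
    unfolding preserves_op_def
  proof (intro ballI)
    fix x y assume Q: "x \<in> Q" "y \<in> Q"
    \<comment> \<open>Both sides are the image under \<phi> of
      \<open>x \<diamondop> (x \<triangleright> y) = x \<star> y\<close>, computed in the
      source.\<close>
    have "op_rack' (\<phi> x) (\<phi> (source.tri x y)) = op_star' (\<phi> x) (\<phi> y)"
      using Q map_rack[unfolded preserves_op_def, rule_format, of x "source.tri x y"]
        map_star[unfolded preserves_op_def, rule_format, of x y]
      by (simp add: source.rack_tri source.tri_mem)
    then show "\<phi> (source.tri x y) = target.tri (\<phi> x) (\<phi> y)"
      using Q map_carrier
      by (intro target.tri_eqI[symmetric]) (auto simp: source.tri_mem)
  qed
  then show ?thesis
    using map_carrier map_rack
    by (simp add: di_rack_morphism_def di_rack_morphism_axioms_def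
        source.di_rack_pairing_tri target.di_rack_pairing_tri)
qed

theorem proposition4p31:
  fixes Q :: "'a set" and op_rack op_star :: "'a \<Rightarrow> 'a \<Rightarrow> 'a"
  assumes "rack_pairing Q op_rack op_star"
  shows "di_rack Q op_rack (pairing_tri Q op_rack op_star) \<and>
    (\<forall>(Q' :: 'b set) op_rack' op_star' \<phi>.
       rack_pairing_morphism Q op_rack op_star Q' op_rack' op_star' \<phi> \<longrightarrow>
       di_rack_morphism Q op_rack (pairing_tri Q op_rack op_star)
         Q' op_rack' (pairing_tri Q' op_rack' op_star') \<phi>)"
  using rack_pairing.di_rack_pairing_tri[OF assms]
    rack_pairing_morphism.di_rack_morphism_pairing_tri by blast

end
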